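(* The theory $\mathrm{RCA}_0^*$ together with the finite cohesiveness principle $\mathrm{FinCOH}$ proves the $\Sigma^0_1$ induction scheme: $\mathrm{RCA}_0^* + \mathrm{FinCOH} \vdash \mathrm{I}\Sigma^0_1$. Equivalently, every model $(M,\mathcal{X})$ of $\mathrm{RCA}_0^* + \mathrm{FinCOH}$ satisfies $\mathrm{I}\Sigma^0_1$.
   Context: We work in the two-sorted language of second-order arithmetic (numbers and sets); a model is a pair $(M,\mathcal{X})$ with $M$ the first-order part and $\mathcal{X}$ a family of subsets of $M$. $\mathbb{N}$ denotes the set of all numbers as formalized inside the theory (so it is interpreted as $M$). $\Sigma^0_n,\Pi^0_n$ are the usual classes of formulas counted by alternating blocks of first-order quantifiers over a $\Delta^0_0$ (bounded) matrix, with first- and second-order free variables (parameters) allowed and no second-order quantifiers. A $\Delta^0_n$ definition is one given by both a $\Sigma^0_n$ and a $\Pi^0_n$ formula. $\mathrm{I}\Sigma^0_n$ is the induction scheme for $\Sigma^0_n$ formulas. $\mathrm{B}\Sigma^0_n$ is the collection scheme for $\Sigma^0_n$ formulas: $\forall a\,[\forall x<a\,\exists y\,\varphi(x,y)\to\exists b\,\forall x<a\,\exists y<b\,\varphi(x,y)]$; as usual, $\mathrm{B}\Sigma^0_n$ is taken to include induction for $\Delta^0_0$ formulas. $\mathrm{RCA}_0$ consists of Robinson arithmetic, $\mathrm{I}\Sigma^0_1$, and comprehension for $\Delta^0_1$ formulas. $\mathrm{RCA}_0^*$ is obtained from $\mathrm{RCA}_0$ by replacing $\mathrm{I}\Sigma^0_1$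 with $\mathrm{B}\Sigma^0_1$ and adding the axiom $\exp$ stating that exponentiation is total. $A\subseteq^* B$ means $\exists b\,\forall x>b\,(x\in A\to x\in B)$. $A^c$ is the complement of $A$. A set $A$ is infinite if it is unbounded in $\mathbb{N}$, i.e. $\forall b\,\exists a\in A\;a>b$. With a standard pairing function $\langle\cdot,\cdot\rangle$, a set $R$ is viewed as a sequence of sets by $R_k=\{x : \langle k,x\rangle\in R\}$. $\mathrm{FinCOH}$ (finite cohesiveness principle): for every $\ell\in\mathbb{N}$ and every sequence of sets $R=(R_k)_{k<\ell}$ of length $\ell$, there is an infinite set $H$ such that for every $k<\ell$, either $H\subseteq^* R_k$ or $H\subseteq^* R_k^c$. (Here $\ell$ ranges over all, possibly nonstandard, numbers of the model.) *)

theory Defs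
  imports Main
begin

section \<open>Structures for the language of second-order arithmetic\<close>

text \<open>
  The first-order part of a structure is the whole type \<open>'a\<close>; as \<open>'a\<close> is arbitrary, this covers
  all first-order parts. The second-order part is a family of subsets of it
  (Henkin semantics: set quantifiers range over this family only).
\<close>

record 'a L2_structure =
  Zero :: 'a ("\<zero>\<index>")
  One :: 'a ("\<one>\<index>")
  Plus :: "'a \<Rightarrow> 'a \<Rightarrow> 'a" (infixl "\<oplus>\<index>" 65)
  Times :: "'a \<Rightarrow> 'a \<Rightarrow> 'a" (infixl "\<otimes>\<index>" 70)
  Less :: "'a \<Rightarrow> 'a \<Rightarrow> bool" (infix "\<prec>\<index>" 50)
  Sets :: "'a set set"

section \<open>Formulas without second-order quantifiers\<close>

text \<open>Number variables and set variables are both indexed by natural numbers, in separate name spaces.\<close>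

datatype tm = Var nat | ZeroT | OneT | PlusT tm tm | TimesT tm tm

datatype fm =
    EqF tm tm
  | LessF tm tm
  | MemF tm nat
  | NotF fm
  | AndF fm fm
  | OrF fm fm
  | ImpF fm fm
  | ExF nat fm
  | AllF nat fm

primrec tm_vars :: "tm \<Rightarrow> nat set" where
  "tm_vars (Var x) = {x}"
| "tm_vars ZeroT = {}"
| "tm_vars OneT = {}"
| "tm_vars (PlusT t u) = tm_vars t \<union> tm_vars u"
| "tm_vars (TimesT t u) = tm_vars t \<union> tm_vars u"

primrec tm_val :: "'a L2_structure \<Rightarrow> (nat \<Rightarrow> 'a) \<Rightarrow> tm \<Rightarrow> 'a" where
  "tm_val M e (Var x) = e x"
| "tm_val M e ZeroT = \<zero>\<^bsub>M\<^esub>"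
| "tm_val M e OneT = \<one>\<^bsub>M\<^esub>"
| "tm_val M e (PlusT t u) = tm_val M e t \<oplus>\<^bsub>M\<^esub> tm_val M e u"
| "tm_val M e (TimesT t u) = tm_val M e t \<otimes>\<^bsub>M\<^esub> tm_val M e u"

primrec sat :: "'a L2_structure \<Rightarrow> (nat \<Rightarrow> 'a set) \<Rightarrow> (nat \<Rightarrow> 'a) \<Rightarrow> fm \<Rightarrow> bool" where
  "sat M E e (EqF t u) \<longleftrightarrow> tm_val M e t = tm_val M e u"
| "sat M E e (LessF t u) \<longleftrightarrow> tm_val M e t \<prec>\<^bsub>M\<^esub> tm_val M e u"
| "sat M E e (MemF t X) \<longleftrightarrow> tm_val M e t \<in> E X"
| "sat M E e (NotF p) \<longleftrightarrow> \<not> sat M E e p"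
| "sat M E e (AndF p q) \<longleftrightarrow> sat M E e p \<and> sat M E e q"
| "sat M E e (OrF p q) \<longleftrightarrow> sat M E e p \<or> sat M E e q"
| "sat M E e (ImpF p q) \<longleftrightarrow> (sat M E e p \<longrightarrow> sat M E e q)"
| "sat M E e (ExF x p) \<longleftrightarrow> (\<exists>a. sat M E (e(x := a)) p)"
| "sat M E e (AllF x p) \<longleftrightarrow> (\<forall>a. sat M E (e(x := a)) p)"

inductive Delta0 :: "fm \<Rightarrow> bool" where
  "Delta0 (EqF t u)"
| "Delta0 (LessF t u)"
| "Delta0 (MemF t X)"
| "Delta0 p \<Longrightarrow> Delta0 (NotF p)"
| "Delta0 p \<Longrightarrow> Delta0 q \<Longrightarrow> Delta0 (AndF p q)"
| "Delta0 p \<Longrightarrow> Delta0 q \<Longrightarrow> Delta0 (OrF p q)"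
| "Delta0 p \<Longrightarrow> Delta0 q \<Longrightarrow> Delta0 (ImpF p q)"
| "Delta0 p \<Longrightarrow> x \<notin> tm_vars t \<Longrightarrow> Delta0 (ExF x (AndF (LessF (Var x) t) p))"
| "Delta0 p \<Longrightarrow> x \<notin> tm_vars t \<Longrightarrow> Delta0 (AllF x (ImpF (LessF (Var x) t) p))"

text \<open>Blocks of quantifiers may be empty, so the classes are cumulative.\<close>

inductive Sigma0 :: "nat \<Rightarrow> fm \<Rightarrow> bool" and Pi0 :: "nat \<Rightarrow> fm \<Rightarrow> bool" where
  "Delta0 p \<Longrightarrow> Sigma0 0 p"
| "Delta0 p \<Longrightarrow> Pi0 0 p"
| "Pi0 n p \<Longrightarrow> Sigma0 (Suc n) p"
| "Sigma0 (Suc n) p \<Longrightarrow> Sigma0 (Suc n) (ExF x p)"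
| "Sigma0 n p \<Longrightarrow> Pi0 (Suc n) p"
| "Pi0 (Suc n) p \<Longrightarrow> Pi0 (Suc n) (AllF x p)"

section \<open>Axioms, as properties of a structure\<close>

text \<open>
  In the schemes, the assignments \<open>E\<close> and \<open>e\<close> supply the set and number parameters.
\<close>

context
  fixes M :: "'a L2_structure" (structure)
begin

definition Robinson :: bool where
  "Robinson \<longleftrightarrow>
     (\<forall>x. x \<oplus> \<one> \<noteq> \<zero>) \<and>
     (\<forall>x y. x \<oplus> \<one> = y \<oplus> \<one> \<longrightarrow> x = y) \<and>
     (\<forall>x. x \<noteq> \<zero> \<longrightarrow> (\<exists>y. x = y \<oplus> \<one>)) \<and>
     (\<forall>x. x \<oplus> \<zero> = x) \<and>
     (\<forall>x y. x \<oplus> (y \<oplus> \<one>) = (x \<oplus> y) \<oplus> \<one>) \<and>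
     (\<forall>x. x \<otimes> \<zero> = \<zero>) \<and>
     (\<forall>x y. x \<otimes> (y \<oplus> \<one>) = (x \<otimes> y) \<oplus> x) \<and>
     (\<forall>x y. x \<prec> y \<longleftrightarrow> (\<exists>z. x \<oplus> (z \<oplus> \<one>) = y))"

definition induction_for :: "(fm \<Rightarrow> bool) \<Rightarrow> bool" where
  "induction_for \<Gamma> \<longleftrightarrow>
     (\<forall>\<phi> x e E. \<Gamma> \<phi> \<longrightarrow> range E \<subseteq> Sets M \<longrightarrow>
        sat M E (e(x := \<zero>)) \<phi> \<longrightarrow>
        (\<forall>a. sat M E (e(x := a)) \<phi> \<longrightarrow> sat M E (e(x := a \<oplus> \<one>)) \<phi>) \<longrightarrow>
        (\<forall>a. sat M E (e(x := a)) \<phi>))"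

definition collection_for :: "(fm \<Rightarrow> bool) \<Rightarrow> bool" where
  "collection_for \<Gamma> \<longleftrightarrow>
     (\<forall>\<phi> x y e E. \<Gamma> \<phi> \<longrightarrow> x \<noteq> y \<longrightarrow> range E \<subseteq> Sets M \<longrightarrow>
        (\<forall>a. (\<forall>u. u \<prec> a \<longrightarrow> (\<exists>v. sat M E (e(x := u, y := v)) \<phi>)) \<longrightarrow>
           (\<exists>b. \<forall>u. u \<prec> a \<longrightarrow> (\<exists>v. v \<prec> b \<and> sat M E (e(x := u, y := v)) \<phi>))))"

definition ISigma0 :: "nat \<Rightarrow> bool" where
  "ISigma0 n \<longleftrightarrow> induction_for (Sigma0 n)"

definition BSigma0 :: "nat \<Rightarrow> bool" where
  "BSigma0 n \<longleftrightarrow> induction_for Delta0 \<and> collection_for (Sigma0 n)"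

definition Delta01_comprehension :: bool where
  "Delta01_comprehension \<longleftrightarrow>
     (\<forall>\<phi> \<psi> x e E. Sigma0 1 \<phi> \<longrightarrow> Pi0 1 \<psi> \<longrightarrow> range E \<subseteq> Sets M \<longrightarrow>
        (\<forall>a. sat M E (e(x := a)) \<phi> \<longleftrightarrow> sat M E (e(x := a)) \<psi>) \<longrightarrow>
        {a. sat M E (e(x := a)) \<phi>} \<in> Sets M)"

text \<open>
  The graph of exponentiation is given by the usual arithmetical definition. \<open>is_beta a b i v\<close> says
  that \<open>v\<close> is the value at \<open>i\<close> of Goedel's beta function, i.e. the remainder of \<open>a\<close> modulo
  \<open>(i + 1) b + 1\<close>, and \<open>is_power x z y\<close> says that some pair \<open>(a, b)\<close> codes in this way
  a sequence starting with \<open>1\<close>, whose first \<open>z\<close> steps are multiplications by \<open>x\<close>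
  and whose value at \<open>z\<close> is \<open>y\<close>.
\<close>

definition is_beta :: "'a \<Rightarrow> 'a \<Rightarrow> 'a \<Rightarrow> 'a \<Rightarrow> bool" where
  "is_beta a b i v \<longleftrightarrow>
     (\<exists>q. a = q \<otimes> ((i \<oplus> \<one>) \<otimes> b \<oplus> \<one>) \<oplus> v) \<and> v \<prec> (i \<oplus> \<one>) \<otimes> b \<oplus> \<one>"

definition is_power :: "'a \<Rightarrow> 'a \<Rightarrow> 'a \<Rightarrow> bool" where
  "is_power x z y \<longleftrightarrow>
     (\<exists>a b. is_beta a b \<zero> \<one> \<and>
        (\<forall>i. i \<prec> z \<longrightarrow> (\<exists>v. is_beta a b i v \<and> is_beta a b (i \<oplus> \<one>) (v \<otimes> x))) \<and>
        is_beta a b z y)"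

definition exp_total :: bool where
  "exp_total \<longleftrightarrow> (\<forall>x z. \<exists>y. is_power x z y)"

text \<open>
  Both sorts of a two-sorted structure are nonempty. This is stated explicitly for the sets, since
  with \<open>Sets M = {}\<close> there would be no assignment \<open>E\<close>, and the schemes would hold vacuously.
\<close>

definition RCA0_star :: bool where
  "RCA0_star \<longleftrightarrow> Sets M \<noteq> {} \<and> Robinson \<and> BSigma0 1 \<and> Delta01_comprehension \<and> exp_total"

section \<open>The finite cohesiveness principle\<close>

definition almost_subset :: "'a set \<Rightarrow> 'a set \<Rightarrow> bool" (infix "\<subseteq>\<^sup>*" 50) where
  "A \<subseteq>\<^sup>* B \<longleftrightarrow> (\<exists>b. \<forall>x. b \<prec> x \<longrightarrow> x \<in> A \<longrightarrow> x \<in> B)"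

text \<open>Infinite in the sense of the structure, as opposed to \<^const>\<open>infinite\<close>.\<close>

definition unbounded :: "'a set \<Rightarrow> bool" where
  "unbounded A \<longleftrightarrow> (\<forall>b. \<exists>a\<in>A. b \<prec> a)"

text \<open>The pairing function customary in second-order arithmetic, \<open>\<langle>i, j\<rangle> = (i + j)\<^sup>2 + i\<close>.\<close>

definition pairing :: "'a \<Rightarrow> 'a \<Rightarrow> 'a" where
  "pairing i j = (i \<oplus> j) \<otimes> (i \<oplus> j) \<oplus> i"

definition section_of :: "'a set \<Rightarrow> 'a \<Rightarrow> 'a set" where
  "section_of R k = {x. pairing k x \<in> R}"

definition FinCOH :: bool where
  "FinCOH \<longleftrightarrow>
     (\<forall>l. \<forall>R\<in>Sets M. \<exists>H\<in>Sets M. unbounded H \<and>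
        (\<forall>k. k \<prec> l \<longrightarrow> H \<subseteq>\<^sup>* section_of R k \<or> H \<subseteq>\<^sup>* - section_of R k))"

end

end

theory Submission
  imports Defs
begin

text \<open>
  If \<open>\<Sigma>\<^sup>0\<^sub>1\<close> induction fails, there is a proper \<open>\<Sigma>\<^sup>0\<^sub>1\<close>-definable cut below some \<open>b\<close>, and with
  collection one gets a nondecreasing function \<open>g\<close> whose graph is in the structure and whose values
  are cofinal in the cut. Since exponentiation is total, the sets of numbers up to \<open>b\<close> are coded by
  the binary digits of the numbers below some \<open>l\<close>; apply the cohesiveness principle to the
  sequence \<open>R\<^sub>e = {z. g z belongs to the set coded by e}\<close> for \<open>e < l\<close>. For any unbounded \<open>H\<close>, the
  image \<open>g ` H\<close> is cofinal in the cut, and some code \<open>e < l\<close> describes, on the cut, a set that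
  contains exactly every other element of this image. Then \<open>R\<^sub>e\<close> splits \<open>H\<close>.
\<close>

lemmas [simp] = Delta0.intros

abbreviation BExF :: "nat \<Rightarrow> tm \<Rightarrow> fm \<Rightarrow> fm" where
  "BExF x t p \<equiv> ExF x (AndF (LessF (Var x) t) p)"

abbreviation BAllF :: "nat \<Rightarrow> tm \<Rightarrow> fm \<Rightarrow> fm" where
  "BAllF x t p \<equiv> AllF x (ImpF (LessF (Var x) t) p)"

abbreviation PairT :: "tm \<Rightarrow> tm \<Rightarrow> tm" where
  "PairT t u \<equiv> PlusT (TimesT (PlusT t u) (PlusT t u)) t"

section \<open>Ordered arithmetic from bounded induction\<close>

locale rca0_star =
  fixes M :: "'a L2_structure" (structure)
  assumes rca0_star: "RCA0_star M"
begin

lemma sets_nonempty: "Sets M \<noteq> {}"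
  and exp_total: "exp_total M"
  and Robinson: "Robinson M"
  and BSigma: "induction_for M Delta0" "collection_for M (Sigma0 1)"
  and compr: "Delta01_comprehension M"
  using rca0_star by (auto simp: RCA0_star_def BSigma0_def)

lemma Delta0_induct:
  assumes "Delta0 p" "\<And>i. E i \<in> Sets M"
    and "sat M E (e(0 := \<zero>)) p"
    and "\<And>a. sat M E (e(0 := a)) p \<Longrightarrow> sat M E (e(0 := a \<oplus> \<one>)) p"
  shows "sat M E (e(0 := a)) p"
  using BSigma(1) assms unfolding induction_for_def by blast

text \<open>Meant for formulas without set variables, where simplification removes \<open>E\<close>
  from premises and conclusion. Induction is available only for assignments into
  \<open>Sets M\<close>; as this family is nonempty, a constant one exists.\<close>

lemma open_induct:
  assumes "Delta0 p"
    and "\<And>E. sat M E (e(0 := \<zero>)) p"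
    and "\<And>a E. sat M E (e(0 := a)) p \<Longrightarrow> sat M E (e(0 := a \<oplus> \<one>)) p"
  shows "\<exists>E. sat M E (e(0 := a)) p"
proof -
  obtain S where "S \<in> Sets M" using sets_nonempty by blast
  then show ?thesis
    using Delta0_induct[of p "\<lambda>_. S" e a] assms by blast
qed

lemma Q [simp]:
  "x \<oplus> \<one> \<noteq> \<zero>"
  "\<zero> \<noteq> x \<oplus> \<one>"
  "x \<oplus> \<one> = y \<oplus> \<one> \<longleftrightarrow> x = y"
  "x \<oplus> \<zero> = x"
  "x \<otimes> \<zero> = \<zero>"
  and add_Suc: "x \<oplus> (y \<oplus> \<one>) = (x \<oplus> y) \<oplus> \<one>"
  and mult_Suc: "x \<otimes> (y \<oplus> \<one>) = (x \<otimes> y) \<oplus> x"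
  and less_def: "x \<prec> y \<longleftrightarrow> (\<exists>z. x \<oplus> (z \<oplus> \<one>) = y)"
  and pred: "x \<noteq> \<zero> \<Longrightarrow> \<exists>y. x = y \<oplus> \<one>"
  using Robinson unfolding Robinson_def by metis+

lemma add_0_left [simp]: "\<zero> \<oplus> x = x"
  using open_induct[of "EqF (PlusT ZeroT (Var 0)) (Var 0)" "\<lambda>_. x" x]
  by (simp add: add_Suc)

lemma add_Suc_left: "(y \<oplus> \<one>) \<oplus> x = (y \<oplus> x) \<oplus> \<one>"
  using open_induct[of "EqF (PlusT (PlusT (Var 1) OneT) (Var 0)) (PlusT (PlusT (Var 1) (Var 0)) OneT)"
      "\<lambda>_. y" x]
  by (simp add: add_Suc)

lemma add_commute: "x \<oplus> y = y \<oplus> x"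
  using open_induct[of "EqF (PlusT (Var 1) (Var 0)) (PlusT (Var 0) (Var 1))" "\<lambda>_. x" y]
  by (simp add: add_Suc add_Suc_left)

lemma add_assoc: "(x \<oplus> y) \<oplus> z = x \<oplus> (y \<oplus> z)"
  using open_induct[of "EqF (PlusT (PlusT (Var 1) (Var 2)) (Var 0)) (PlusT (Var 1) (PlusT (Var 2) (Var 0)))"
      "(\<lambda>_. x)(2 := y)" z]
  by (simp add: add_Suc)

lemma add_left_commute: "x \<oplus> (y \<oplus> z) = y \<oplus> (x \<oplus> z)"
  by (metis add_assoc add_commute)

lemmas add_ac = add_assoc add_commute add_left_commute

lemma mult_0_left [simp]: "\<zero> \<otimes> x = \<zero>"
  using open_induct[of "EqF (TimesT ZeroT (Var 0)) ZeroT" "\<lambda>_. x" x]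
  by (simp add: mult_Suc)

lemma mult_Suc_left: "(y \<oplus> \<one>) \<otimes> x = y \<otimes> x \<oplus> x"
  using open_induct[of "EqF (TimesT (PlusT (Var 1) OneT) (Var 0)) (PlusT (TimesT (Var 1) (Var 0)) (Var 0))"
      "\<lambda>_. y" x]
  by (simp add: mult_Suc add_ac)

lemma mult_commute: "x \<otimes> y = y \<otimes> x"
  using open_induct[of "EqF (TimesT (Var 1) (Var 0)) (TimesT (Var 0) (Var 1))" "\<lambda>_. x" y]
  by (simp add: mult_Suc mult_Suc_left)

lemma distrib_left: "x \<otimes> (y \<oplus> z) = x \<otimes> y \<oplus> x \<otimes> z"
  using open_induct[of "EqF (TimesT (Var 1) (PlusT (Var 2) (Var 0)))
      (PlusT (TimesT (Var 1) (Var 2)) (TimesT (Var 1) (Var 0)))" "(\<lambda>_. x)(2 := y)" z]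
  by (simp add: mult_Suc add_assoc[symmetric])

lemma distrib_right: "(y \<oplus> z) \<otimes> x = y \<otimes> x \<oplus> z \<otimes> x"
  by (metis distrib_left mult_commute)

lemma mult_1 [simp]: "\<one> \<otimes> x = x" "x \<otimes> \<one> = x"
  using mult_Suc[of x \<zero>] by (simp_all add: mult_commute)

lemma add_cancel_right [simp]: "x \<oplus> z = y \<oplus> z \<longleftrightarrow> x = y"
  using open_induct[of "ImpF (EqF (PlusT (Var 1) (Var 0)) (PlusT (Var 2) (Var 0))) (EqF (Var 1) (Var 2))"
      "(\<lambda>_. x)(2 := y)" z]
  by (auto simp: add_Suc)

lemma add_cancel_left [simp]: "z \<oplus> x = z \<oplus> y \<longleftrightarrow> x = y"
  using add_cancel_right[of x z y] by (simp only: add_commute)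

definition le :: "'a \<Rightarrow> 'a \<Rightarrow> bool" (infix "\<preceq>" 50) where
  "x \<preceq> y \<longleftrightarrow> x \<prec> y \<or> x = y"

lemma le_iff: "x \<preceq> y \<longleftrightarrow> (\<exists>z. x \<oplus> z = y)"
proof
  show "x \<preceq> y \<Longrightarrow> \<exists>z. x \<oplus> z = y"
    unfolding le_def less_def using Q(4) by blast
  assume "\<exists>z. x \<oplus> z = y"
  then obtain z where z: "x \<oplus> z = y" ..
  show "x \<preceq> y"
  proof (cases "z = \<zero>")
    case False
    then obtain w where "z = w \<oplus> \<one>" using pred by blast
    then show ?thesis unfolding le_def less_def using z by blast
  qed (use z in \<open>simp add: le_def\<close>)
qed

lemma less_irrefl [simp]: "\<not> x \<prec> x"
proof
  assume "x \<prec> x"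
  then obtain z where "x \<oplus> (z \<oplus> \<one>) = x \<oplus> \<zero>" unfolding less_def by auto
  then show False unfolding add_cancel_left by simp
qed

lemma less_trans: "x \<prec> y \<Longrightarrow> y \<prec> z \<Longrightarrow> x \<prec> z"
proof -
  assume "x \<prec> y" "y \<prec> z"
  then obtain u v where "z = x \<oplus> (u \<oplus> \<one>) \<oplus> (v \<oplus> \<one>)" unfolding less_def by auto
  then have "z = x \<oplus> ((u \<oplus> \<one> \<oplus> v) \<oplus> \<one>)" by (simp only: add_assoc)
  then show "x \<prec> z" unfolding less_def by auto
qed

lemma less_Suc: "x \<prec> y \<oplus> \<one> \<longleftrightarrow> x \<preceq> y"
  unfolding le_iff less_def[of x "y \<oplus> \<one>"] by (simp add: add_Suc)

lemma Suc_le: "x \<oplus> \<one> \<preceq> y \<longleftrightarrow> x \<prec> y"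
  unfolding le_iff less_def[of x y] by (simp add: add_Suc add_Suc_left)

lemma zero_le: "\<zero> \<preceq> x"
  unfolding le_iff by simp

lemma not_less_zero [simp]: "\<not> x \<prec> \<zero>"
  unfolding less_def by (simp add: add_Suc)

lemma less_linear: "x \<prec> y \<or> x = y \<or> y \<prec> x"
proof -
  have "\<zero> \<prec> y \<or> \<zero> = y" using zero_le[of y] by (simp add: le_def)
  moreover have "a \<oplus> \<one> \<prec> y \<or> a \<oplus> \<one> = y \<or> y \<prec> a \<oplus> \<one>"
    if "a \<prec> y \<or> a = y \<or> y \<prec> a" for a
    using that Suc_le[of a y] less_Suc[of y a] by (auto simp: le_def)
  ultimately show ?thesis
    using open_induct[of "OrF (LessF (Var 0) (Var 1)) (OrF (EqF (Var 0) (Var 1)) (LessF (Var 1) (Var 0)))"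
      "\<lambda>_. y" x] by auto
qed

sublocale ord: linorder le "Less M"
proof
  fix x y z
  show "x \<prec> y \<longleftrightarrow> x \<preceq> y \<and> \<not> y \<preceq> x"
    unfolding le_def by (metis less_trans less_irrefl)
  show "x \<preceq> x" by (simp add: le_def)
  show "x \<preceq> z" if "x \<preceq> y" "y \<preceq> z" using that less_trans unfolding le_def by metis
  show "x = y" if "x \<preceq> y" "y \<preceq> x" using that unfolding le_def by (metis less_trans less_irrefl)
  show "x \<preceq> y \<or> y \<preceq> x" using less_linear unfolding le_def by metis
qed

lemma add_less_cancel [simp]: "x \<oplus> z \<prec> y \<oplus> z \<longleftrightarrow> x \<prec> y" "z \<oplus> x \<prec> z \<oplus> y \<longleftrightarrow> x \<prec> y"
  and add_le_cancel [simp]: "x \<oplus> z \<preceq> y \<oplus> z \<longleftrightarrow> x \<preceq> y" "z \<oplus> x \<preceq> z \<oplus> y \<longleftrightarrow> x \<preceq> y"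
proof -
  show *: "z \<oplus> x \<prec> z \<oplus> y \<longleftrightarrow> x \<prec> y" for z unfolding less_def by (simp add: add_assoc)
  show "x \<oplus> z \<prec> y \<oplus> z \<longleftrightarrow> x \<prec> y" using *[of z] by (simp only: add_commute)
  then show "x \<oplus> z \<preceq> y \<oplus> z \<longleftrightarrow> x \<preceq> y" by (simp add: le_def)
  show "z \<oplus> x \<preceq> z \<oplus> y \<longleftrightarrow> x \<preceq> y" using *[of z] by (simp add: le_def)
qed

lemma le_add [simp]: "x \<preceq> x \<oplus> y" "x \<preceq> y \<oplus> x"
  unfolding le_iff using add_commute by blast+

lemma mult_le_mono: "x \<preceq> y \<Longrightarrow> x \<otimes> z \<preceq> y \<otimes> z"
  unfolding le_iff using distrib_right by metis

lemma le_mult: "z \<noteq> \<zero> \<Longrightarrow> x \<preceq> x \<otimes> z"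
proof -
  assume "z \<noteq> \<zero>"
  then obtain w where "x \<otimes> z = x \<otimes> w \<oplus> x" using pred mult_Suc by blast
  then show ?thesis using le_add(2) by simp
qed

section \<open>Division with remainder and pairing\<close>

lemma div_unique:
  assumes "q \<otimes> m \<oplus> v = q' \<otimes> m \<oplus> v'" "v \<prec> m" "v' \<prec> m"
  shows "q = q' \<and> v = v'"
proof -
  have *: False if "q \<prec> q'" "q \<otimes> m \<oplus> v = q' \<otimes> m \<oplus> v'" "v \<prec> m" for q v q' v'
  proof -
    have "q' \<otimes> m \<oplus> v' = q \<otimes> m \<oplus> v" using that(2) ..
    also have "\<dots> \<prec> q \<otimes> m \<oplus> m" using that(3) by simp
    also have "\<dots> \<preceq> q' \<otimes> m"
      using mult_le_mono[of "q \<oplus> \<one>" q' m] that(1) by (simp add: Suc_le mult_Suc_left)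
    also have "\<dots> \<preceq> q' \<otimes> m \<oplus> v'" by simp
    finally show False by simp
  qed
  then have "q = q'" using assms less_linear by metis
  then show ?thesis using assms by simp
qed

lemma div_exists:
  assumes "m \<noteq> \<zero>" shows "\<exists>q r. x = q \<otimes> m \<oplus> r \<and> r \<prec> m"
proof -
  \<comment> \<open>The quotient is at most the dividend since \<open>m \<noteq> \<zero>\<close>, so
    existence of a division is a bounded statement and open to induction.\<close>
  let ?p = "BExF 2 (PlusT (Var 0) OneT) (BExF 3 (Var 1)
     (EqF (Var 0) (PlusT (TimesT (Var 2) (Var 1)) (Var 3))))"
  have sat_p: "sat M E ((\<lambda>_. m)(0 := a)) ?p \<longleftrightarrow> (\<exists>q r. a = q \<otimes> m \<oplus> r \<and> r \<prec> m)" for E a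
  proof -
    have "q \<preceq> q \<otimes> m \<oplus> r" for q r
      using le_mult[OF assms] le_add(1)[of "q \<otimes> m" r] by (rule ord.order_trans)
    then show ?thesis by (simp add: less_Suc) blast
  qed
  have "\<exists>q r. a \<oplus> \<one> = q \<otimes> m \<oplus> r \<and> r \<prec> m" if a: "a = q \<otimes> m \<oplus> r" "r \<prec> m" for a q r
  proof (cases "r \<oplus> \<one> = m")
    case True
    then have "a \<oplus> \<one> = (q \<oplus> \<one>) \<otimes> m \<oplus> \<zero>" "\<zero> \<prec> m"
      using a assms zero_le[of m] by (auto simp: mult_Suc_left add_assoc le_def)
    then show ?thesis by blast
  next
    case False
    then have "a \<oplus> \<one> = q \<otimes> m \<oplus> (r \<oplus> \<one>)" "r \<oplus> \<one> \<prec> m"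
      using a Suc_le[of r m] by (auto simp: add_assoc le_def)
    then show ?thesis by blast
  qed
  note step = this
  have "\<exists>E. sat M E ((\<lambda>_. m)(0 := x)) ?p"
  proof (rule open_induct)
    show "sat M E ((\<lambda>_. m)(0 := \<zero>)) ?p" for E
      unfolding sat_p using assms zero_le[of m] by (intro exI[of _ \<zero>]) (auto simp: le_def)
    show "sat M E ((\<lambda>_. m)(0 := a \<oplus> \<one>)) ?p" if "sat M E ((\<lambda>_. m)(0 := a)) ?p" for a E
      using that step unfolding sat_p by blast
  qed simp
  then show ?thesis unfolding sat_p by simp
qed

lemma square_mono: "x \<preceq> y \<Longrightarrow> x \<otimes> x \<preceq> y \<otimes> y"
  using mult_le_mono[of x y x] mult_le_mono[of x y y] by (metis mult_commute ord.order_trans)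

lemma pairing_le: "i \<preceq> pairing M i j" "j \<preceq> pairing M i j"
proof -
  let ?s = "i \<oplus> j"
  have "?s \<preceq> ?s \<otimes> ?s" using le_mult[of ?s ?s] by (cases "?s = \<zero>") auto
  then have "?s \<preceq> pairing M i j"
    unfolding pairing_def using le_add(1) ord.order_trans by blast
  then show "i \<preceq> pairing M i j" "j \<preceq> pairing M i j"
    using le_add ord.order_trans by blast+
qed

text \<open>Pairs with sum s have codes from s^2 to s^2 + s, all below (s + 1)^2. Hence the code
  determines the sum, and then both components by cancellation.\<close>

lemma pairing_inj [simp]: "pairing M i j = pairing M i' j' \<longleftrightarrow> i = i' \<and> j = j'"
proof
  have *: False if "i \<oplus> j \<prec> i' \<oplus> j'" and eq: "pairing M i j = pairing M i' j'" for i j i' j'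
  proof -
    let ?s = "i \<oplus> j" let ?t = "i' \<oplus> j'"
    have "pairing M i j \<preceq> ?s \<otimes> ?s \<oplus> ?s"
      unfolding pairing_def by simp
    also have "\<dots> \<preceq> ?s \<otimes> ?s \<oplus> ?s \<oplus> ?s" by (rule le_add)
    also have "\<dots> \<prec> (?s \<oplus> \<one>) \<otimes> (?s \<oplus> \<one>)"
      by (simp only: mult_Suc mult_Suc_left less_Suc add_assoc[symmetric])
    also have "\<dots> \<preceq> ?t \<otimes> ?t" using square_mono[of "?s \<oplus> \<one>" ?t] that(1) Suc_le by blast
    also have "\<dots> \<preceq> pairing M i' j'" unfolding pairing_def by (rule le_add)
    finally show False using eq by simp
  qed
  assume eq: "pairing M i j = pairing M i' j'"
  then have "i \<oplus> j = i' \<oplus> j'" using * less_linear by metis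
  then show "i = i' \<and> j = j'" using eq by (auto simp: pairing_def)
qed simp

text \<open>Evaluating a \<open>PairT\<close> term unfolds to sums and products; this folds the
  result back to \<open>pairing\<close>.\<close>

lemmas [simp] = pairing_def[symmetric]

section \<open>Comprehension, induction and collection in terms of sets\<close>

lemma Delta0_Sigma0_1: "Delta0 p \<Longrightarrow> Sigma0 1 p"
  and Delta0_Pi0_1: "Delta0 p \<Longrightarrow> Pi0 1 p"
  by (simp_all add: Sigma0_Pi0.intros)

text \<open>A bounded formula is its own \<open>Pi0 1\<close> counterpart. With \<open>P\<close>
  separate, what remains in each application is the evaluation of a concrete formula.\<close>

lemma set_comprehension:
  assumes "Delta0 p" "\<And>i. E i \<in> Sets M" "\<And>a. sat M E (e(x := a)) p \<longleftrightarrow> P a"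
  shows "{a. P a} \<in> Sets M"
proof -
  have "range E \<subseteq> Sets M" using assms(2) by (simp add: image_subset_iff)
  then have "{a. sat M E (e(x := a)) p} \<in> Sets M"
    using compr[unfolded Delta01_comprehension_def, rule_format,
        OF Delta0_Sigma0_1[OF assms(1)] Delta0_Pi0_1[OF assms(1)]] by simp
  then show ?thesis using assms(3) by simp
qed

lemma tm_val_fresh: "\<exists>n. \<forall>z\<ge>n. \<forall>e a. tm_val M (e(z := a)) t = tm_val M e t"
proof -
  have "tm_val M (e(z := a)) t = tm_val M e t" if "z \<notin> tm_vars t" for z e a
    using that by (induction t) auto
  moreover have "finite (tm_vars t)" by (induction t) auto
  then obtain n where "\<forall>x\<in>tm_vars t. x < n" using finite_nat_set_iff_bounded by blast
  ultimately show ?thesis by (intro exI[of _ n]) (auto dest: leD)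
qed

text \<open>Freshness in semantic form: it provides variables for new quantifiers around an
  arbitrary formula, with no need for a syntactic account of free variables.\<close>

lemma sat_fresh: "\<exists>n. \<forall>z\<ge>n. \<forall>e a. sat M E (e(z := a)) p \<longleftrightarrow> sat M E e p"
proof -
  have bin: "\<exists>n. \<forall>z\<ge>n. P z \<and> Q z"
    if PQ: "\<exists>n. \<forall>z\<ge>n. P z" "\<exists>n. \<forall>z\<ge>n. Q z" for P Q :: "nat \<Rightarrow> bool"
  proof -
    obtain m n where "\<forall>z\<ge>m. P z" "\<forall>z\<ge>n. Q z" using PQ by blast
    then show ?thesis by (intro exI[of _ "max m n"]) simp
  qed
  \<comment> \<open>The bound is raised above the quantified variable as well, because the two
    updates commute only for distinct variables.\<close>
  have upd: "\<exists>n. \<forall>z\<ge>n. \<forall>e a b. sat M E (e(z := a, x := b)) p \<longleftrightarrow> sat M E (e(x := b)) p"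
    if p: "\<exists>n. \<forall>z\<ge>n. \<forall>e a. sat M E (e(z := a)) p \<longleftrightarrow> sat M E e p" for x p
  proof -
    obtain n where n: "\<And>z e a. n \<le> z \<Longrightarrow> sat M E (e(z := a)) p \<longleftrightarrow> sat M E e p"
      using p by blast
    have "sat M E (e(z := a, x := b)) p \<longleftrightarrow> sat M E (e(x := b)) p" if "max n (Suc x) \<le> z" for z e a b
      using n[of z "e(x := b)" a] that by (simp add: fun_upd_twist[of z x])
    then show ?thesis by blast
  qed
  show ?thesis
  proof (induction p)
    case (EqF t u)
    show ?case using bin[OF tm_val_fresh[of t] tm_val_fresh[of u]] unfolding sat.simps by metis
  next
    case (LessF t u)
    show ?case using bin[OF tm_val_fresh[of t] tm_val_fresh[of u]] unfolding sat.simps by metis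
  next
    case (MemF t X)
    show ?case using tm_val_fresh[of t] unfolding sat.simps by metis
  next
    case (AndF p q)
    show ?case using bin[OF AndF] unfolding sat.simps by metis
  next
    case (OrF p q)
    show ?case using bin[OF OrF] unfolding sat.simps by metis
  next
    case (ImpF p q)
    show ?case using bin[OF ImpF] unfolding sat.simps by metis
  next
    case (ExF x p)
    show ?case using upd[OF ExF] unfolding sat.simps by metis
  next
    case (AllF x p)
    show ?case using upd[OF AllF] unfolding sat.simps by metis
  qed auto
qed

text \<open>The set consists of the codes of the related pairs. Both components are at most the
  code, so decoding takes only bounded quantifiers.\<close>

lemma binary_comprehension:
  assumes "Delta0 p" "\<And>i. E i \<in> Sets M" "x \<noteq> y"
    and "\<And>u v. sat M E (e(x := u, y := v)) p \<longleftrightarrow> P u v"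
  shows "\<exists>S\<in>Sets M. \<forall>u v. pairing M u v \<in> S \<longleftrightarrow> P u v"
proof -
  obtain n where n: "\<forall>z\<ge>n. \<forall>e a. sat M E (e(z := a)) p \<longleftrightarrow> sat M E e p"
    using sat_fresh by blast
  define w where "w = max n (Suc (max x y))"
  have w: "w \<noteq> x" "w \<noteq> y" "n \<le> w" unfolding w_def by auto
  let ?q = "BExF x (PlusT (Var w) OneT) (BExF y (PlusT (Var w) OneT)
    (AndF (EqF (Var w) (PairT (Var x) (Var y))) p))"
  have "sat M E (e(w := a)) ?q \<longleftrightarrow> (\<exists>u v. a = pairing M u v \<and> P u v)" for a
  proof -
    have "sat M E (e(w := a, x := u, y := v)) p \<longleftrightarrow> P u v" for u v
    proof -
      have "e(w := a, x := u, y := v) = e(x := u, y := v, w := a)" using w by auto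
      then show ?thesis using n w(3) assms(4)[of u v] by metis
    qed
    then show ?thesis using w assms(3) pairing_le by (auto simp: less_Suc)
  qed
  then have "{a. \<exists>u v. a = pairing M u v \<and> P u v} \<in> Sets M"
    using w assms by (intro set_comprehension[of ?q E e w]) auto
  moreover have "\<forall>u v. pairing M u v \<in> {a. \<exists>u v. a = pairing M u v \<and> P u v} \<longleftrightarrow> P u v" by simp
  ultimately show ?thesis by blast
qed

text \<open>The extension of the predicate becomes a set parameter, so induction for one atomic
  formula suffices. All later inductions inside the structure have this form, after a comprehension
  step.\<close>

lemma set_induct [consumes 1, case_names 0 Suc]:
  assumes "{a. P a} \<in> Sets M" "P \<zero>" "\<And>a. P a \<Longrightarrow> P (a \<oplus> \<one>)"
  shows "P a"
  using Delta0_induct[of "MemF (Var 0) 0" "\<lambda>_. {a. P a}" "\<lambda>_. a" a] assms by simp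

lemma set_least:
  assumes "S \<in> Sets M" "b \<in> S"
  shows "\<exists>x\<in>S. x \<preceq> b \<and> (\<forall>y. y \<prec> x \<longrightarrow> y \<notin> S)"
proof (rule ccontr)
  assume neg: "\<not> ?thesis"
  \<comment> \<open>Without a least element, induction on \<open>n\<close> keeps all numbers below
    \<open>n\<close> and up to \<open>b\<close> out of \<open>S\<close>;
    \<open>n = b \<oplus> \<one>\<close> then excludes \<open>b\<close> itself.\<close>
  have "{n. \<forall>y. y \<prec> n \<longrightarrow> y \<preceq> b \<longrightarrow> y \<notin> S} \<in> Sets M"
    by (rule set_comprehension[of "BAllF 1 (Var 0) (ImpF (LessF (Var 1) (PlusT (Var 2) OneT))
      (NotF (MemF (Var 1) 0)))" "\<lambda>_. S" "\<lambda>_. b" 0]) (simp_all add: assms less_Suc)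
  then have "\<forall>y. y \<prec> b \<oplus> \<one> \<longrightarrow> y \<preceq> b \<longrightarrow> y \<notin> S"
  proof (induction rule: set_induct)
    case (Suc a)
    show ?case
    proof (intro allI impI notI)
      fix y assume "y \<prec> a \<oplus> \<one>" "y \<preceq> b" "y \<in> S"
      then have "y = a" using Suc by (auto simp: less_Suc le_def)
      then show False using neg Suc \<open>y \<in> S\<close> \<open>y \<preceq> b\<close> ord.order_trans
        by (metis le_def)
    qed
  qed simp
  then show False using assms(2) by (simp add: less_Suc)
qed

text \<open>The collection scheme enters the proof only through this instance, for an atomic formula
  about a set of pairs.\<close>

lemma set_collection:
  assumes "S \<in> Sets M" "\<And>u. u \<prec> a \<Longrightarrow> \<exists>v. pairing M u v \<in> S"
  shows "\<exists>b. \<forall>u. u \<prec> a \<longrightarrow> (\<exists>v. v \<prec> b \<and> pairing M u v \<in> S)"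
proof -
  have "Sigma0 1 (MemF (PairT (Var 0) (Var 1)) 0)"
    by (intro Delta0_Sigma0_1) simp
  moreover have "range (\<lambda>_. S) \<subseteq> Sets M" using assms(1) by auto
  ultimately have "\<forall>a. (\<forall>u. u \<prec> a \<longrightarrow>
        (\<exists>v. sat M (\<lambda>_. S) ((\<lambda>_. a)(0 := u, 1 := v)) (MemF (PairT (Var 0) (Var 1)) 0))) \<longrightarrow>
      (\<exists>b. \<forall>u. u \<prec> a \<longrightarrow>
        (\<exists>v. v \<prec> b \<and> sat M (\<lambda>_. S) ((\<lambda>_. a)(0 := u, 1 := v)) (MemF (PairT (Var 0) (Var 1)) 0)))"
    using BSigma(2) unfolding collection_for_def by (metis zero_neq_one)
  then show ?thesis using assms(2) by simp
qed

section \<open>Powers of two and binary digits\<close>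

lemma add_eq_0 [simp]: "x \<oplus> y = \<zero> \<longleftrightarrow> x = \<zero> \<and> y = \<zero>"
proof (cases "y = \<zero>")
  case False
  then obtain w where "y = w \<oplus> \<one>" using pred by blast
  then show ?thesis by (simp add: add_Suc)
qed simp

lemma one_neq_zero [simp]: "\<one> \<noteq> \<zero>"
  using Q(1)[of \<zero>] by simp

lemma is_beta_unique: "is_beta M a b i v \<Longrightarrow> is_beta M a b i w \<Longrightarrow> v = w"
  unfolding is_beta_def using div_unique by metis

lemma is_beta_le: "is_beta M a b i v \<Longrightarrow> v \<preceq> a"
  unfolding is_beta_def using le_add by blast

lemma is_beta_set: "\<exists>S\<in>Sets M. \<forall>i v. pairing M i v \<in> S \<longleftrightarrow> is_beta M a b i v"
proof -
  obtain S where S: "S \<in> Sets M" using sets_nonempty by blast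
  let ?m = "PlusT (TimesT (PlusT (Var 0) OneT) (Var 3)) OneT"
  let ?p = "AndF (BExF 4 (PlusT (Var 2) OneT) (EqF (Var 2) (PlusT (TimesT (Var 4) ?m) (Var 1))))
    (LessF (Var 1) ?m)"
  \<comment> \<open>The modulus is nonzero, so the quotient in the beta function is bounded by
    \<open>a\<close> and the graph has a bounded definition.\<close>
  have "q \<preceq> a" if "a = q \<otimes> ((i \<oplus> \<one>) \<otimes> b \<oplus> \<one>) \<oplus> v" for q i v
  proof -
    have "q \<preceq> q \<otimes> ((i \<oplus> \<one>) \<otimes> b \<oplus> \<one>)" by (rule le_mult) simp
    also have "\<dots> \<preceq> a" using that by simp
    finally show ?thesis .
  qed
  then have "sat M (\<lambda>_. S) ((\<lambda>_. a)(3 := b, 0 := i, 1 := v)) ?p \<longleftrightarrow> is_beta M a b i v" for i v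
    unfolding is_beta_def by (simp add: less_Suc) blast
  then show ?thesis
    by (intro binary_comprehension[of ?p "\<lambda>_. S" 0 1 "(\<lambda>_. a)(3 := b)"]) (simp_all add: S)
qed

text \<open>The pair that codes the computation of 2^z is a parameter defining all powers up to that
  one. Values of the beta function are at most \<open>a\<close>, which gives the bound
  \<open>y = a \<oplus> \<one>\<close>; it keeps later quantifiers over powers bounded.\<close>

lemma powers_of_two:
  "\<exists>S\<in>Sets M. \<exists>p y. p \<zero> = \<one> \<and> (\<forall>i. i \<prec> z \<longrightarrow> p (i \<oplus> \<one>) = p i \<oplus> p i) \<and>
     (\<forall>i. i \<preceq> z \<longrightarrow> p i \<prec> y \<and> (\<forall>v. pairing M i v \<in> S \<longleftrightarrow> v = p i))"
proof -
  obtain w a b where 0: "is_beta M a b \<zero> \<one>"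
    and step: "\<And>i. i \<prec> z \<Longrightarrow> \<exists>v. is_beta M a b i v \<and> is_beta M a b (i \<oplus> \<one>) (v \<otimes> (\<one> \<oplus> \<one>))"
    and last: "is_beta M a b z w"
    using exp_total unfolding exp_total_def is_power_def by blast
  obtain S where S: "S \<in> Sets M" "\<And>i v. pairing M i v \<in> S \<longleftrightarrow> is_beta M a b i v"
    using is_beta_set by blast
  define p where "p i = (THE v. is_beta M a b i v)" for i
  have p_eqI: "p i = v" if "is_beta M a b i v" for i v
    unfolding p_def using that is_beta_unique by blast
  have p: "is_beta M a b i (p i)" if "i \<preceq> z" for i
    using that step[of i] last p_eqI unfolding le_def by metis
  have "p (i \<oplus> \<one>) = p i \<oplus> p i" if "i \<prec> z" for i
    using step[OF that] p_eqI by (force simp: distrib_left)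
  moreover have "p i \<prec> a \<oplus> \<one> \<and> (\<forall>v. pairing M i v \<in> S \<longleftrightarrow> v = p i)" if "i \<preceq> z" for i
    using is_beta_le[OF p[OF that]] p[OF that] p_eqI[of i] unfolding S(2) less_Suc by metis
  ultimately show ?thesis
    using p_eqI[OF 0] by (intro bexI[OF _ S(1)] exI[of _ p] exI[of _ "a \<oplus> \<one>"]) simp
qed

text \<open>\<open>digit P k\<close> is meant for a power \<open>P\<close> of two: the binary digit of \<open>k\<close> of weight \<open>P\<close> is one.\<close>

definition digit :: "'a \<Rightarrow> 'a \<Rightarrow> bool" where
  "digit P k \<longleftrightarrow> (\<exists>q r. k = q \<otimes> (P \<oplus> P) \<oplus> (P \<oplus> r) \<and> r \<prec> P)"

text \<open>By uniqueness of division, the digit depends only on the remainder modulo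
  \<open>P \<oplus> P\<close>.\<close>

lemma digit_iff:
  assumes "s \<prec> P \<oplus> P"
  shows "digit P (q \<otimes> (P \<oplus> P) \<oplus> s) \<longleftrightarrow> P \<preceq> s"
proof
  assume "digit P (q \<otimes> (P \<oplus> P) \<oplus> s)"
  then obtain q' r where "q \<otimes> (P \<oplus> P) \<oplus> s = q' \<otimes> (P \<oplus> P) \<oplus> (P \<oplus> r)" "r \<prec> P"
    unfolding digit_def by blast
  then have "s = P \<oplus> r" using div_unique assms by (metis add_less_cancel(2))
  then show "P \<preceq> s" by simp
next
  assume "P \<preceq> s"
  then obtain r where "s = P \<oplus> r" unfolding le_iff by blast
  then show "digit P (q \<otimes> (P \<oplus> P) \<oplus> s)" unfolding digit_def using assms by auto
qed

text \<open>Only the quotient changes. Applied to a higher power of two, this says that adding it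
  preserves the lower digits.\<close>

lemma digit_add_multiple:
  assumes "P \<noteq> \<zero>"
  shows "digit P (k \<oplus> u \<otimes> (P \<oplus> P)) \<longleftrightarrow> digit P k"
proof -
  obtain q s where k: "k = q \<otimes> (P \<oplus> P) \<oplus> s" "s \<prec> P \<oplus> P"
    using div_exists[of "P \<oplus> P" k] assms by auto
  then have "k \<oplus> u \<otimes> (P \<oplus> P) = (q \<oplus> u) \<otimes> (P \<oplus> P) \<oplus> s"
    by (simp only: distrib_right add_ac)
  then show ?thesis using k digit_iff by metis
qed

lemma digit_top:
  assumes "k \<prec> P"
  shows "\<not> digit P k" "digit P (k \<oplus> P)"
proof -
  have *: "k \<prec> P \<oplus> P" "k \<oplus> P \<prec> P \<oplus> P" using assms ord.less_le_trans[OF assms le_add(1)] by auto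
  show "\<not> digit P k" using digit_iff[OF *(1), of \<zero>] assms by simp
  show "digit P (k \<oplus> P)" using digit_iff[OF *(2), of \<zero>] by simp
qed

text \<open>Formulas have access to \<open>p\<close> only through its graph \<open>S\<close>. A
  weight whose digit is one is a summand of \<open>k\<close>, so the quantifiers over the weight and
  the quotient can be bounded by \<open>k\<close>.\<close>

lemma digit_set:
  assumes "S \<in> Sets M"
    and S: "\<And>i v. i \<preceq> z \<Longrightarrow> pairing M i v \<in> S \<longleftrightarrow> v = p i"
    and pos: "\<And>i. i \<preceq> z \<Longrightarrow> p i \<noteq> \<zero>"
  shows "\<exists>B\<in>Sets M. \<forall>k i. i \<preceq> z \<longrightarrow> (pairing M k i \<in> B \<longleftrightarrow> digit (p i) k)"
proof -
  let ?f = "BExF 2 (PlusT (Var 0) OneT) (AndF (MemF (PairT (Var 1) (Var 2)) 0)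
     (BExF 3 (PlusT (Var 0) OneT) (BExF 4 (Var 2)
       (EqF (Var 0) (PlusT (TimesT (Var 3) (PlusT (Var 2) (Var 2))) (PlusT (Var 2) (Var 4)))))))"
  let ?P = "\<lambda>k i. \<exists>P. P \<preceq> k \<and> pairing M i P \<in> S \<and>
    (\<exists>q. q \<preceq> k \<and> (\<exists>r. r \<prec> P \<and> k = q \<otimes> (P \<oplus> P) \<oplus> (P \<oplus> r)))"
  have "\<exists>B\<in>Sets M. \<forall>k i. pairing M k i \<in> B \<longleftrightarrow> ?P k i"
    by (rule binary_comprehension[of ?f "\<lambda>_. S" 0 1 "\<lambda>_. \<zero>"])
      (simp_all add: assms(1) less_Suc)
  moreover have "?P k i \<longleftrightarrow> digit (p i) k" if i: "i \<preceq> z" for k i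
  proof
    show "?P k i \<Longrightarrow> digit (p i) k" unfolding digit_def by (auto simp: S[OF i])
    assume "digit (p i) k"
    then obtain q r where k: "k = q \<otimes> (p i \<oplus> p i) \<oplus> (p i \<oplus> r)" "r \<prec> p i"
      unfolding digit_def by blast
    have "q \<preceq> q \<otimes> (p i \<oplus> p i)" using pos[OF i] by (intro le_mult) simp
    also have "\<dots> \<preceq> k" unfolding k(1) by simp
    finally have "q \<preceq> k" .
    moreover have "p i \<preceq> p i \<oplus> r" by simp
    then have "p i \<preceq> k" unfolding k(1) using le_add(2) ord.order_trans by blast
    ultimately show "?P k i" using k S[OF i] by blast
  qed
  ultimately show ?thesis by (metis (no_types, lifting))
qed

abbreviation IffF :: "fm \<Rightarrow> fm \<Rightarrow> fm" where
  "IffF p q \<equiv> AndF (ImpF p q) (ImpF q p)"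

lemma powers_pos:
  assumes S: "S \<in> Sets M" "\<And>i v. i \<preceq> z \<Longrightarrow> pairing M i v \<in> S \<longleftrightarrow> v = p i"
    and p: "p \<zero> = \<one>" "\<And>i. i \<prec> z \<Longrightarrow> p (i \<oplus> \<one>) = p i \<oplus> p i"
    and i: "i \<preceq> z"
  shows "p i \<noteq> \<zero>"
proof -
  \<comment> \<open>\<open>Q(4)\<close> is removed from the simplifier because it would erase the
    second component \<open>\<zero>\<close> before the term is folded to
    \<open>pairing\<close>.\<close>
  have "{i. i \<preceq> z \<longrightarrow> pairing M i \<zero> \<notin> S} \<in> Sets M"
    by (rule set_comprehension[of "ImpF (LessF (Var 0) (PlusT (Var 1) OneT))
          (NotF (MemF (PairT (Var 0) ZeroT) 0))" "\<lambda>_. S" "\<lambda>_. z" 0])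
      (simp_all add: S(1) less_Suc del: Q(4))
  then have "i \<preceq> z \<longrightarrow> pairing M i \<zero> \<notin> S"
  proof (induction i rule: set_induct)
    case 0
    then show ?case using S(2)[of \<zero> \<zero>] p(1) one_neq_zero by metis
  next
    case (Suc a)
    show ?case
    proof
      assume a: "a \<oplus> \<one> \<preceq> z"
      then have "a \<prec> z" by (simp add: Suc_le)
      then have "p a \<noteq> \<zero>" using Suc S(2)[of a \<zero>] by (auto simp: le_def)
      then show "pairing M (a \<oplus> \<one>) \<zero> \<notin> S"
        using S(2)[OF a] p(2)[OF \<open>a \<prec> z\<close>] by (metis add_eq_0)
    qed
  qed
  then show ?thesis using i S(2)[OF i] by metis
qed

text \<open>Induction on \<open>n\<close> from \<open>i \<oplus> \<one>\<close>, where the quotient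
  is one; each further step doubles it. This is what makes \<open>digit_add_multiple\<close>
  applicable to \<open>p n\<close>.\<close>

lemma powers_dvd:
  assumes S: "S \<in> Sets M" "\<And>i v. i \<preceq> z \<Longrightarrow> pairing M i v \<in> S \<longleftrightarrow> v = p i"
    and p: "\<And>i. i \<prec> z \<Longrightarrow> p (i \<oplus> \<one>) = p i \<oplus> p i" "\<And>i. i \<preceq> z \<Longrightarrow> p i \<prec> y"
    and pos: "\<And>i. i \<preceq> z \<Longrightarrow> p i \<noteq> \<zero>"
    and i: "i \<prec> n" "n \<preceq> z"
  shows "\<exists>u. p n = u \<otimes> (p i \<oplus> p i)"
proof -
  \<comment> \<open>The value \<open>p n\<close> is replaced by a \<open>v\<close> found in
    \<open>S\<close> below \<open>y\<close>, and the quotient is bounded by \<open>v\<close>, so the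
    claim is a bounded formula.\<close>
  let ?P = "\<lambda>n. n \<preceq> z \<longrightarrow> i \<prec> n \<longrightarrow>
    (\<exists>v. v \<prec> y \<and> pairing M n v \<in> S \<and> (\<exists>u. u \<preceq> v \<and> v = u \<otimes> (p i \<oplus> p i)))"
  have iz: "i \<prec> z" using i ord.less_le_trans by blast
  then have i0: "p i \<oplus> p i \<noteq> \<zero>" using pos[of i] by (simp add: le_def)
  have "{n. ?P n} \<in> Sets M"
    by (rule set_comprehension[of "ImpF (LessF (Var 0) (PlusT (Var 1) OneT)) (ImpF (LessF (Var 2) (Var 0))
          (BExF 4 (Var 3) (AndF (MemF (PairT (Var 0) (Var 4)) 0)
            (BExF 5 (PlusT (Var 4) OneT) (EqF (Var 4) (TimesT (Var 5) (PlusT (Var 6) (Var 6))))))))"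
        "\<lambda>_. S" "(\<lambda>_. z)(2 := i, 3 := y, 6 := p i)" 0])
      (simp_all add: S(1) less_Suc)
  then have "?P n"
  proof (induction n rule: set_induct)
    case (Suc a)
    show ?case
    proof (intro impI)
      assume a: "a \<oplus> \<one> \<preceq> z" "i \<prec> a \<oplus> \<one>"
      then have az: "a \<prec> z" by (simp add: Suc_le)
      then have az': "a \<preceq> z" by (simp add: le_def)
      have "\<exists>u. p a \<oplus> p a = u \<otimes> (p i \<oplus> p i)"
      proof (cases "i = a")
        case True
        then show ?thesis by (intro exI[of _ \<one>]) simp
      next
        case False
        then have "i \<prec> a" using a(2) by (simp add: less_Suc le_def)
        then obtain u where "p a = u \<otimes> (p i \<oplus> p i)" using Suc az' S(2)[OF az'] by auto
        then have "p a \<oplus> p a = (u \<oplus> u) \<otimes> (p i \<oplus> p i)" by (simp only: distrib_right)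
        then show ?thesis ..
      qed
      then obtain u where u: "p (a \<oplus> \<one>) = u \<otimes> (p i \<oplus> p i)" using p(1)[OF az] by auto
      moreover have "u \<preceq> u \<otimes> (p i \<oplus> p i)" using i0 by (rule le_mult)
      ultimately show "\<exists>v. v \<prec> y \<and> pairing M (a \<oplus> \<one>) v \<in> S \<and>
          (\<exists>u. u \<preceq> v \<and> v = u \<otimes> (p i \<oplus> p i))"
        using S(2)[OF a(1)] p(2)[OF a(1)] by metis
    qed
  qed simp
  then show ?thesis using i S(2)[OF i(2)] by auto
qed

section \<open>Codes that alternate along a set\<close>

text \<open>
  The digits of \<open>e\<close> change value exactly after the elements of \<open>D\<close>, so that consecutive elements
  of \<open>D\<close> are separated by the set coded by \<open>e\<close>.
\<close>

lemma alternating_code: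
  "\<exists>B\<in>Sets M. \<exists>l. \<forall>D\<in>Sets M. \<exists>e. e \<prec> l \<and>
    (\<forall>x. x \<prec> b \<longrightarrow> (pairing M e (x \<oplus> \<one>) \<in> B \<longleftrightarrow> \<not> (pairing M e x \<in> B \<longleftrightarrow> x \<in> D)))"
proof -
  \<comment> \<open>Positions 0 to \<open>b\<close> need digits, since
    \<open>x \<oplus> \<one>\<close> reaches \<open>b\<close>; their codes are the numbers below
    \<open>p (b \<oplus> \<one>)\<close>.\<close>
  define z where "z = b \<oplus> \<one>"
  obtain S p y where S: "S \<in> Sets M" "\<And>i v. i \<preceq> z \<Longrightarrow> pairing M i v \<in> S \<longleftrightarrow> v = p i"
    and p: "p \<zero> = \<one>" "\<And>i. i \<prec> z \<Longrightarrow> p (i \<oplus> \<one>) = p i \<oplus> p i" "\<And>i. i \<preceq> z \<Longrightarrow> p i \<prec> y"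
    using powers_of_two[of z] by blast
  have pos: "p i \<noteq> \<zero>" if "i \<preceq> z" for i using powers_pos S p(1,2) that by blast
  obtain B where B: "B \<in> Sets M" "\<And>k i. i \<preceq> z \<Longrightarrow> pairing M k i \<in> B \<longleftrightarrow> digit (p i) k"
    using digit_set[OF S pos] by blast
  have digit_add: "digit (p i) (e \<oplus> p n) \<longleftrightarrow> digit (p i) e" if i: "i \<prec> n" "n \<preceq> z" for i n e
  proof -
    obtain u where "p n = u \<otimes> (p i \<oplus> p i)"
      using powers_dvd[OF S p(2,3) pos i] by blast
    moreover have "p i \<noteq> \<zero>" using i ord.less_le_trans pos by (metis le_def)
    ultimately show ?thesis using digit_add_multiple by metis
  qed
  \<comment> \<open>A code below \<open>p n\<close> is kept or increased by \<open>p n\<close>,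
    according to the digit wanted at position \<open>n\<close>.\<close>
  have extend: "\<exists>e'. e' \<prec> p (n \<oplus> \<one>) \<and> (digit (p n) e' \<longleftrightarrow> v) \<and>
      (\<forall>i. i \<prec> n \<longrightarrow> (digit (p i) e' \<longleftrightarrow> digit (p i) e))"
    if "e \<prec> p n" "n \<prec> z" for e n v
  proof (cases v)
    case True
    then show ?thesis
      using that digit_top(2)[OF that(1)] digit_add[of _ n] p(2)[OF that(2)]
      by (intro exI[of _ "e \<oplus> p n"]) (simp add: le_def)
  next
    case False
    then show ?thesis
      using that digit_top(1)[OF that(1)] p(2)[OF that(2)] ord.less_le_trans[OF that(1) le_add(1)]
      by (intro exI[of _ e]) simp
  qed
  \<comment> \<open>Both \<open>B\<close> and the bound \<open>p z\<close> are fixed before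
    \<open>D\<close>, so one sequence of coded sets serves every \<open>D\<close>.\<close>
  have "\<exists>e. e \<prec> p z \<and>
    (\<forall>x. x \<prec> b \<longrightarrow> (pairing M e (x \<oplus> \<one>) \<in> B \<longleftrightarrow> \<not> (pairing M e x \<in> B \<longleftrightarrow> x \<in> D)))"
    if D: "D \<in> Sets M" for D
  proof -
    let ?R = "\<lambda>e x. pairing M e (x \<oplus> \<one>) \<in> B \<longleftrightarrow> \<not> (pairing M e x \<in> B \<longleftrightarrow> x \<in> D)"
    \<comment> \<open>A code with digits at positions up to \<open>n\<close> lies below
      \<open>v = p (n \<oplus> \<one>)\<close>; naming this power through \<open>S\<close> and
      \<open>y\<close> makes the claim bounded.\<close>
    let ?P = "\<lambda>n. n \<preceq> b \<longrightarrow> (\<exists>v. v \<prec> y \<and> pairing M (n \<oplus> \<one>) v \<in> S \<and>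
      (\<exists>e. e \<prec> v \<and> (\<forall>x. x \<prec> n \<longrightarrow> ?R e x)))"
    have "{n. ?P n} \<in> Sets M"
      by (rule set_comprehension[of "ImpF (LessF (Var 0) (PlusT (Var 1) OneT))
            (BExF 3 (Var 2) (AndF (MemF (PairT (PlusT (Var 0) OneT) (Var 3)) 0)
              (BExF 4 (Var 3) (BAllF 5 (Var 0)
                (IffF (MemF (PairT (Var 4) (PlusT (Var 5) OneT)) 1)
                  (NotF (IffF (MemF (PairT (Var 4) (Var 5)) 1) (MemF (Var 5) 2))))))))"
          "(\<lambda>_. S)(1 := B, 2 := D)" "(\<lambda>_. b)(2 := y)" 0])
        (simp_all add: S(1) B(1) D less_Suc iff_conv_conj_imp)
    then have "?P b"
    proof (induction b rule: set_induct)
      case 0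
      have "\<zero> \<prec> z" using less_Suc[of \<zero> b] zero_le[of b] unfolding z_def by simp
      then have "\<zero> \<oplus> \<one> \<preceq> z" unfolding Suc_le .
      then show ?case
        using S(2)[of "\<zero> \<oplus> \<one>"] p(3)[of "\<zero> \<oplus> \<one>"] pos[of "\<zero> \<oplus> \<one>"] zero_le[of "p (\<zero> \<oplus> \<one>)"]
        by (metis le_def not_less_zero)
    next
      case (Suc n)
      show ?case
      proof
        assume "n \<oplus> \<one> \<preceq> b"
        then have n: "n \<prec> b" "n \<oplus> \<one> \<prec> z" "n \<oplus> \<one> \<oplus> \<one> \<preceq> z"
          unfolding z_def by (simp_all add: Suc_le)
        then have nz: "n \<oplus> \<one> \<preceq> z" by (simp add: le_def)
        have "n \<preceq> b" using n(1) by (simp add: le_def)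
        then have "\<exists>e. e \<prec> p (n \<oplus> \<one>) \<and> (\<forall>x. x \<prec> n \<longrightarrow> ?R e x)"
          using Suc S(2)[OF nz] by auto
        then obtain e where e: "e \<prec> p (n \<oplus> \<one>)" "\<And>x. x \<prec> n \<Longrightarrow> ?R e x" by blast
        \<comment> \<open>The recurrence at \<open>n\<close> dictates the new digit at position
          \<open>n \<oplus> \<one>\<close>.\<close>
        obtain e' where e': "e' \<prec> p (n \<oplus> \<one> \<oplus> \<one>)"
          "digit (p (n \<oplus> \<one>)) e' \<longleftrightarrow> \<not> (pairing M e n \<in> B \<longleftrightarrow> n \<in> D)"
          "\<And>i. i \<prec> n \<oplus> \<one> \<Longrightarrow> digit (p i) e' \<longleftrightarrow> digit (p i) e"
          using extend[OF e(1) n(2)] by blast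
        have same: "pairing M e' i \<in> B \<longleftrightarrow> pairing M e i \<in> B" if "i \<preceq> n" for i
        proof -
          have i: "i \<prec> n \<oplus> \<one>" using that by (simp add: less_Suc)
          then have "i \<preceq> z" using less_trans[OF i n(2)] by (simp add: le_def)
          then show ?thesis using e'(3)[OF i] B(2) by blast
        qed
        have "?R e' x" if "x \<prec> n \<oplus> \<one>" for x
        proof (cases "x = n")
          case True
          have "n \<preceq> n" by simp
          then show ?thesis using True e'(2) B(2)[OF nz] same[of n] by blast
        next
          case False
          then have "x \<prec> n" using that by (simp add: less_Suc le_def)
          then have x: "x \<prec> n" "x \<preceq> n" "x \<oplus> \<one> \<preceq> n" unfolding Suc_le by (simp_all add: le_def)
          show ?thesis using e(2)[OF x(1)] same[OF x(2)] same[OF x(3)] by blast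
        qed
        then show "\<exists>v. v \<prec> y \<and> pairing M (n \<oplus> \<one> \<oplus> \<one>) v \<in> S \<and>
            (\<exists>e. e \<prec> v \<and> (\<forall>x. x \<prec> n \<oplus> \<one> \<longrightarrow> ?R e x))"
          using e'(1) S(2)[OF n(3)] p(3)[OF n(3)] by blast
      qed
    qed
    moreover have "z \<preceq> z" by simp
    ultimately show ?thesis using S(2)[of z] unfolding z_def[symmetric] by auto
  qed
  then show ?thesis using B(1) by blast
qed

section \<open>A bounded step function from a failure of induction\<close>

text \<open>Take for \<open>g z\<close> the least number without a witness below \<open>z\<close>.
  It is at most \<open>b\<close>, which has no witness at all, and grows with \<open>z\<close>.
  Every number up to \<open>g z\<close> does have a witness; by collection some \<open>z'\<close>
  bounds all of these, and then \<open>g z'\<close> is larger.\<close>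

lemma step_function:
  assumes T: "T \<in> Sets M"
    and zero: "\<exists>y. pairing M \<zero> y \<in> T"
    and step: "\<And>x. \<exists>y. pairing M x y \<in> T \<Longrightarrow> \<exists>y. pairing M (x \<oplus> \<one>) y \<in> T"
    and b: "\<And>y. pairing M b y \<notin> T"
  shows "\<exists>G\<in>Sets M. \<exists>g. (\<forall>z x. pairing M z x \<in> G \<longleftrightarrow> x = g z) \<and> (\<forall>z. g z \<preceq> b) \<and>
    (\<forall>z z'. z \<preceq> z' \<longrightarrow> g z \<preceq> g z') \<and> (\<forall>z. \<exists>z'. g z \<prec> g z')"
proof -
  let ?N = "\<lambda>z x. \<forall>y. y \<prec> z \<longrightarrow> pairing M x y \<notin> T"
  define least where "least z x \<longleftrightarrow> ?N z x \<and> (\<forall>u. u \<prec> x \<longrightarrow> \<not> ?N z u)" for z x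
  define g where "g z = (THE x. least z x)" for z
  have "\<exists>G\<in>Sets M. \<forall>z x. pairing M z x \<in> G \<longleftrightarrow> least z x"
    unfolding least_def
    by (rule binary_comprehension[of
          "AndF (BAllF 2 (Var 0) (NotF (MemF (PairT (Var 1) (Var 2)) 0)))
            (BAllF 3 (Var 1) (NotF (BAllF 2 (Var 0) (NotF (MemF (PairT (Var 3) (Var 2)) 0)))))"
          "\<lambda>_. T" 0 1 "\<lambda>_. \<zero>"]) (simp_all add: T)
  then obtain G where G: "G \<in> Sets M" "\<And>z x. pairing M z x \<in> G \<longleftrightarrow> least z x" by blast
  have ex: "\<exists>x. least z x \<and> x \<preceq> b" for z
  proof -
    have "{x. ?N z x} \<in> Sets M"
      by (rule set_comprehension[of "BAllF 2 (Var 1) (NotF (MemF (PairT (Var 0) (Var 2)) 0))"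
            "\<lambda>_. T" "\<lambda>_. z" 0]) (simp_all add: T)
    moreover have "b \<in> {x. ?N z x}" using b by simp
    ultimately obtain x where "x \<in> {x. ?N z x}" "x \<preceq> b" "\<forall>y. y \<prec> x \<longrightarrow> y \<notin> {x. ?N z x}"
      using set_least by blast
    then show ?thesis unfolding least_def mem_Collect_eq by blast
  qed
  have uniq: "x = x'" if "least z x" "least z x'" for z x x'
    using that less_linear[of x x'] unfolding least_def by blast
  have g_eqI: "g z = x" if "least z x" for z x
    unfolding g_def using that uniq by blast
  have g: "least z (g z)" "g z \<preceq> b" for z using ex[of z] g_eqI by auto
  have mono: "g z \<preceq> g z'" if "z \<preceq> z'" for z z'
  proof (rule ccontr)
    assume "\<not> g z \<preceq> g z'"
    then have "\<not> ?N z (g z')" using g(1)[of z] unfolding least_def ord.not_le by blast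
    then obtain y where "y \<prec> z" "pairing M (g z') y \<in> T" by blast
    then show False using g(1)[of z'] ord.less_le_trans[OF _ that] unfolding least_def by blast
  qed
  \<comment> \<open>For \<open>g z\<close> itself the witness comes from closure under successor, as
    its predecessor lies below \<open>g z\<close>.\<close>
  have in_cut: "\<exists>y. pairing M u y \<in> T" if "u \<preceq> g z" for u z
  proof -
    have below: "\<exists>y. pairing M u y \<in> T" if "u \<prec> g z" for u
      using g(1)[of z] that unfolding least_def by blast
    show ?thesis
    proof (cases "u = g z")
      case True
      show ?thesis
      proof (cases "u = \<zero>")
        case False
        then obtain v where v: "u = v \<oplus> \<one>" using pred by blast
        then have "v \<prec> g z" using True Suc_le[of v "g z"] by simp
        then show ?thesis using step below v by blast
      qed (use zero in simp)
    qed (use that below in \<open>simp add: le_def\<close>)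
  qed
  have "\<exists>z'. g z \<prec> g z'" for z
  proof -
    have "\<exists>z'. \<forall>u. u \<prec> g z \<oplus> \<one> \<longrightarrow> (\<exists>v. v \<prec> z' \<and> pairing M u v \<in> T)"
      using in_cut[of _ z] by (intro set_collection[OF T]) (simp add: less_Suc)
    then obtain z' where z': "\<And>u. u \<preceq> g z \<Longrightarrow> \<exists>v. v \<prec> z' \<and> pairing M u v \<in> T"
      unfolding less_Suc by blast
    have "\<not> g z' \<preceq> g z" using z' g(1)[of z'] unfolding least_def by blast
    then show ?thesis unfolding ord.not_le by blast
  qed
  moreover have "\<forall>z x. pairing M z x \<in> G \<longleftrightarrow> x = g z" using G(2) g(1) g_eqI by blast
  ultimately show ?thesis using G(1) g(2) mono by blast
qed

section \<open>Cohesiveness against step functions\<close>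

text \<open>
  A code that is wrong for \<open>{g h | h \<in> H}\<close> somewhere below a value of \<open>g\<close> is wrong already for a
  bounded part of \<open>H\<close>. By collection one such part would refute all codes at once, although each
  part has a code.
\<close>

lemma step_function_code:
  assumes G: "G \<in> Sets M" "\<And>z x. pairing M z x \<in> G \<longleftrightarrow> x = g z"
    and bounded: "\<And>z. g z \<preceq> b"
    and mono: "\<And>z z'. z \<preceq> z' \<Longrightarrow> g z \<preceq> g z'"
    and H: "H \<in> Sets M"
    and B: "B \<in> Sets M"
    and code: "\<And>D. D \<in> Sets M \<Longrightarrow> \<exists>e. e \<prec> l \<and>
      (\<forall>x. x \<prec> b \<longrightarrow> (pairing M e (x \<oplus> \<one>) \<in> B \<longleftrightarrow> \<not> (pairing M e x \<in> B \<longleftrightarrow> x \<in> D)))"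
  shows "\<exists>e. e \<prec> l \<and> (\<forall>z x. x \<prec> g z \<longrightarrow>
      (pairing M e (x \<oplus> \<one>) \<in> B \<longleftrightarrow> \<not> (pairing M e x \<in> B \<longleftrightarrow> x \<in> g ` H)))"
proof (rule ccontr)
  assume neg: "\<not> ?thesis"
  \<comment> \<open>The image of \<open>H\<close> under \<open>g\<close> is defined by an unbounded
    quantifier, so comprehension is applied to its parts from arguments below \<open>z\<close>,
    uniformly in \<open>z\<close>.\<close>
  have "\<exists>D\<in>Sets M. \<forall>z x. pairing M z x \<in> D \<longleftrightarrow> (\<exists>h. h \<prec> z \<and> h \<in> H \<and> pairing M h x \<in> G)"
    by (rule binary_comprehension[of "BExF 2 (Var 0) (AndF (MemF (Var 2) 1)
          (MemF (PairT (Var 2) (Var 1)) 0))" "(\<lambda>_. G)(1 := H)" 0 1 "\<lambda>_. \<zero>"]) (simp_all add: G(1) H)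
  then obtain D where D: "D \<in> Sets M"
    "\<And>z x. pairing M z x \<in> D \<longleftrightarrow> (\<exists>h. h \<prec> z \<and> h \<in> H \<and> x = g h)"
    unfolding G(2) by blast
  let ?R = "\<lambda>e x d. pairing M e (x \<oplus> \<one>) \<in> B \<longleftrightarrow> \<not> (pairing M e x \<in> B \<longleftrightarrow> d)"
  \<comment> \<open>By monotonicity a value below \<open>g z\<close> can only come from an argument
    below \<open>z\<close>, so the part is already correct there.\<close>
  have D_eq: "pairing M z x \<in> D \<longleftrightarrow> x \<in> g ` H" if "x \<prec> g z" for z x
  proof -
    have "h \<prec> z" if "x = g h" for h
      using mono[of z h] that \<open>x \<prec> g z\<close> unfolding ord.not_le[symmetric] by blast
    then show ?thesis unfolding D(2) by blast
  qed
  \<comment> \<open>\<open>F\<close> collects the pairs of a code \<open>e\<close> and a stage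
    \<open>z\<close> such that \<open>e\<close> errs below \<open>g z\<close>. The value
    \<open>g z\<close> is named by \<open>y\<close> through its graph, with \<open>b\<close> as
    bound.\<close>
  let ?F = "\<lambda>e z. \<exists>x. x \<prec> b \<and> (\<exists>y. y \<preceq> b \<and> pairing M z y \<in> G \<and> x \<prec> y) \<and>
    \<not> ?R e x (pairing M z x \<in> D)"
  have F_iff: "?F e z \<longleftrightarrow> (\<exists>x. x \<prec> g z \<and> \<not> ?R e x (x \<in> g ` H))" for e z
  proof -
    have "x \<prec> b" if "x \<prec> g z" for x using ord.less_le_trans[OF that bounded] .
    then show ?thesis unfolding G(2) using bounded[of z] D_eq[of _ z] by auto
  qed
  have "\<exists>F\<in>Sets M. \<forall>e z. pairing M e z \<in> F \<longleftrightarrow> ?F e z"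
    by (rule binary_comprehension[of "BExF 3 (Var 2) (AndF
          (BExF 4 (PlusT (Var 2) OneT) (AndF (MemF (PairT (Var 1) (Var 4)) 0) (LessF (Var 3) (Var 4))))
          (NotF (IffF (MemF (PairT (Var 0) (PlusT (Var 3) OneT)) 1)
            (NotF (IffF (MemF (PairT (Var 0) (Var 3)) 1) (MemF (PairT (Var 1) (Var 3)) 2))))))"
        "(\<lambda>_. G)(1 := B, 2 := D)" 0 1 "\<lambda>_. b"])
      (simp_all add: G(1) B D(1) less_Suc iff_conv_conj_imp)
  then obtain F where F: "F \<in> Sets M"
    "\<And>e z. pairing M e z \<in> F \<longleftrightarrow> (\<exists>x. x \<prec> g z \<and> \<not> ?R e x (x \<in> g ` H))"
    unfolding F_iff by blast
  have "\<exists>z. pairing M e z \<in> F" if "e \<prec> l" for e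
    using neg that unfolding F(2) by blast
  then obtain w where w: "\<And>e. e \<prec> l \<Longrightarrow> \<exists>z. z \<prec> w \<and> pairing M e z \<in> F"
    using set_collection[OF F(1), of l] by blast
  \<comment> \<open>The stage \<open>w\<close> lies beyond an error of every code, yet its part of
    the image is a set of the structure and so has an error-free code.\<close>
  have "{x. pairing M w x \<in> D} \<in> Sets M"
    by (rule set_comprehension[of "MemF (PairT (Var 1) (Var 0)) 0" "\<lambda>_. D" "\<lambda>_. w" 0])
      (simp_all add: D(1))
  from code[OF this] obtain e where e: "e \<prec> l" "\<And>x. x \<prec> b \<Longrightarrow> ?R e x (pairing M w x \<in> D)"
    by auto
  obtain z x where z: "z \<prec> w" and x: "x \<prec> g z" "\<not> ?R e x (x \<in> g ` H)"
    using w[OF e(1)] unfolding F(2) by blast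
  have "x \<prec> g w" using ord.less_le_trans[OF x(1) mono] z by (simp add: le_def)
  moreover have "x \<prec> b" using ord.less_le_trans[OF x(1) bounded] .
  ultimately show False using e(2) x(2) D_eq by blast
qed

lemma no_step_function:
  assumes fincoh: "FinCOH M"
    and G: "G \<in> Sets M" "\<And>z x. pairing M z x \<in> G \<longleftrightarrow> x = g z"
    and bounded: "\<And>z. g z \<preceq> b"
    and mono: "\<And>z z'. z \<preceq> z' \<Longrightarrow> g z \<preceq> g z'"
    and no_max: "\<And>z. \<exists>z'. g z \<prec> g z'"
  shows False
proof -
  obtain B l where B: "B \<in> Sets M"
    and code: "\<And>D. D \<in> Sets M \<Longrightarrow> \<exists>e. e \<prec> l \<and>
      (\<forall>x. x \<prec> b \<longrightarrow> (pairing M e (x \<oplus> \<one>) \<in> B \<longleftrightarrow> \<not> (pairing M e x \<in> B \<longleftrightarrow> x \<in> D)))"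
    using alternating_code[of b] by blast
  have "\<exists>R\<in>Sets M. \<forall>k z. pairing M k z \<in> R \<longleftrightarrow> (\<exists>x. x \<preceq> b \<and> pairing M z x \<in> G \<and> pairing M k x \<in> B)"
    by (rule binary_comprehension[of "BExF 3 (PlusT (Var 2) OneT) (AndF (MemF (PairT (Var 1) (Var 3)) 0)
          (MemF (PairT (Var 0) (Var 3)) 1))" "(\<lambda>_. G)(1 := B)" 0 1 "\<lambda>_. b"])
      (simp_all add: G(1) B less_Suc)
  then obtain R where R: "R \<in> Sets M" "\<And>k z. pairing M k z \<in> R \<longleftrightarrow> pairing M k (g z) \<in> B"
    unfolding G(2) using bounded by blast
  obtain H where H: "H \<in> Sets M" "unbounded M H"
    and coh: "\<And>k. k \<prec> l \<Longrightarrow> almost_subset M H (section_of M R k) \<or> almost_subset M H (- section_of M R k)"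
    using fincoh R(1) unfolding FinCOH_def by blast
  obtain e where e: "e \<prec> l"
    and alt: "\<And>z x. x \<prec> g z \<Longrightarrow>
      pairing M e (x \<oplus> \<one>) \<in> B \<longleftrightarrow> \<not> (pairing M e x \<in> B \<longleftrightarrow> x \<in> g ` H)"
    using step_function_code[OF G bounded mono H(1) B code] by blast
  \<comment> \<open>\<open>v\<close> records which alternative of cohesiveness holds: past
    \<open>s\<close>, the digit of \<open>e\<close> at \<open>g h\<close> is constant for
    \<open>h\<close> in \<open>H\<close>.\<close>
  obtain s v where v: "\<And>h. h \<in> H \<Longrightarrow> s \<prec> h \<Longrightarrow> pairing M e (g h) \<in> B \<longleftrightarrow> v"
    using coh[OF e] unfolding almost_subset_def section_of_def by (auto simp: R(2))
  obtain h0 where h0: "h0 \<in> H" "s \<prec> h0" using H(2) unfolding unbounded_def by blast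
  obtain z where z: "g h0 \<prec> g z" using no_max by blast
  obtain h1 where h1: "h1 \<in> H" "z \<prec> h1" using H(2) unfolding unbounded_def by blast
  have h01: "g h0 \<prec> g h1" using ord.less_le_trans[OF z mono] h1(2) by (simp add: le_def)
  \<comment> \<open>Right after \<open>g h0\<close> the digit flips away from \<open>v\<close>. It
    can flip back only after a value of \<open>g\<close> on \<open>H\<close>; such values above
    \<open>g h0\<close> come from arguments beyond \<open>h0\<close> and carry digit
    \<open>v\<close>, so none is met. Hence the wrong digit persists up to
    \<open>g h1\<close>.\<close>
  have "{x. g h0 \<prec> x \<longrightarrow> x \<preceq> g h1 \<longrightarrow> (pairing M e x \<in> B \<longleftrightarrow> \<not> v)} \<in> Sets M"
    by (rule set_comprehension[of "ImpF (LessF (Var 1) (Var 0)) (ImpF (LessF (Var 0) (PlusT (Var 2) OneT))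
          (IffF (MemF (PairT (Var 3) (Var 0)) 0) (if v then NotF (EqF ZeroT ZeroT) else EqF ZeroT ZeroT)))"
        "\<lambda>_. B" "(\<lambda>_. g h0)(2 := g h1, 3 := e)" 0])
      (auto simp add: B less_Suc)
  then have "g h0 \<prec> x \<longrightarrow> x \<preceq> g h1 \<longrightarrow> (pairing M e x \<in> B \<longleftrightarrow> \<not> v)" for x
  proof (induction x rule: set_induct)
    case (Suc a)
    show ?case
    proof (intro impI)
      assume a: "g h0 \<prec> a \<oplus> \<one>" "a \<oplus> \<one> \<preceq> g h1"
      then have a': "a \<prec> g h1" by (simp add: Suc_le)
      show "pairing M e (a \<oplus> \<one>) \<in> B \<longleftrightarrow> \<not> v"
      proof (cases "a = g h0")
        case True
        then show ?thesis using alt[OF a'] v[OF h0] h0(1) by blast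
      next
        case False
        then have "g h0 \<prec> a" using a(1) by (simp add: less_Suc le_def)
        then have IH: "pairing M e a \<in> B \<longleftrightarrow> \<not> v" using Suc a' by (simp add: le_def)
        have "a \<noteq> g h" if "h \<in> H" for h
        proof
          assume "a = g h"
          then have "h0 \<prec> h"
            using mono[of h h0] \<open>g h0 \<prec> a\<close> unfolding ord.not_le[symmetric] by blast
          then have "s \<prec> h" using h0(2) less_trans by blast
          then show False using v[OF that] IH \<open>a = g h\<close> by blast
        qed
        then show ?thesis using alt[OF a'] IH by blast
      qed
    qed
  qed simp
  from this[of "g h1"] have "pairing M e (g h1) \<in> B \<longleftrightarrow> \<not> v" using h01 by simp
  moreover have "s \<prec> h1"
  proof -
    have "h0 \<prec> h1" using mono[of h1 h0] h01 unfolding ord.not_le[symmetric] by blast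
    then show ?thesis using h0(2) less_trans by blast
  qed
  ultimately show False using v[OF h1(1)] by blast
qed

section \<open>From existential formulas to sets\<close>

text \<open>A single bound dominates the witnesses of a whole block of existential quantifiers.\<close>

lemma Sigma0_1_contract:
  assumes "Sigma0 1 p"
  shows "\<exists>q z. N \<le> z \<and> Delta0 q \<and> (\<forall>e. sat M E e p \<longleftrightarrow> (\<exists>a. sat M E (e(z := a)) q))"
proof -
  have "n = 1 \<Longrightarrow> \<exists>q z. N \<le> z \<and> Delta0 q \<and> (\<forall>e. sat M E e p \<longleftrightarrow> (\<exists>a. sat M E (e(z := a)) q))"
    if "Sigma0 n p" for n p
    using that
  proof (induction arbitrary: N rule: Sigma0_Pi0.inducts(1)[where ?P2.0 = "\<lambda>_ _. True"])
    \<comment> \<open>Here \<open>p\<close> is bounded, and a vacuous quantifier over a fresh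
      variable is added.\<close>
    case (3 n p)
    then have p: "Delta0 p" by (auto elim: Pi0.cases)
    obtain m where "\<And>z e a. m \<le> z \<Longrightarrow> sat M E (e(z := a)) p \<longleftrightarrow> sat M E e p"
      using sat_fresh[of E p] by blast
    from this[OF max.cobounded1] show ?case using p max.cobounded2 by blast
  next
    case (4 n p x)
    then obtain q z where q: "Delta0 q" "\<And>e. sat M E e p \<longleftrightarrow> (\<exists>a. sat M E (e(z := a)) q)" by blast
    obtain m where m: "\<And>w e a. m \<le> w \<Longrightarrow> sat M E (e(w := a)) q \<longleftrightarrow> sat M E e q"
      using sat_fresh[of E q] by blast
    \<comment> \<open>The new variable must avoid \<open>q\<close> and also \<open>x\<close> and
      \<open>z\<close>, whose bounded quantifiers have it as bounding term.\<close>
    define w where "w = max (max m N) (Suc (max x z))"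
    have w: "m \<le> w" "N \<le> w" "w \<noteq> x" "w \<noteq> z" unfolding w_def by auto
    let ?q = "BExF x (Var w) (BExF z (Var w) q)"
    have fresh: "sat M E (e(w := c, x := u, z := a)) q \<longleftrightarrow> sat M E (e(x := u, z := a)) q" for e c u a
    proof -
      have "e(w := c, x := u, z := a) = e(x := u, z := a, w := c)" using w by auto
      then show ?thesis using m[OF w(1)] by metis
    qed
    have "sat M E e (ExF x p) \<longleftrightarrow> (\<exists>c. sat M E (e(w := c)) ?q)" for e
    proof
      assume "sat M E e (ExF x p)"
      then obtain u a where ua: "sat M E (e(x := u, z := a)) q" unfolding sat.simps q(2) by blast
      have "u \<prec> u \<oplus> a \<oplus> \<one>" "a \<prec> u \<oplus> a \<oplus> \<one>" by (simp_all add: less_Suc)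
      then show "\<exists>c. sat M E (e(w := c)) ?q"
        using ua w by (intro exI[of _ "u \<oplus> a \<oplus> \<one>"]) (auto simp: fresh)
    next
      assume "\<exists>c. sat M E (e(w := c)) ?q"
      then show "sat M E e (ExF x p)" using w by (auto simp: fresh q(2))
    qed
    moreover have "Delta0 ?q" using q(1) w by simp
    ultimately show ?case using w(2) by blast
  qed auto
  then show ?thesis using assms by blast
qed

text \<open>The bounded matrix is turned into a set \<open>T\<close> of pairs, so the rest of the
  argument is about sets only. Choosing the witness variable above \<open>x\<close> keeps the two
  coordinates apart.\<close>

lemma Sigma0_1_set:
  assumes "Sigma0 1 p" "\<And>i. E i \<in> Sets M"
  shows "\<exists>T\<in>Sets M. \<forall>u. sat M E (e(x := u)) p \<longleftrightarrow> (\<exists>y. pairing M u y \<in> T)"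
proof -
  obtain q z where q: "Suc x \<le> z" "Delta0 q"
    "\<And>e. sat M E e p \<longleftrightarrow> (\<exists>a. sat M E (e(z := a)) q)"
    using Sigma0_1_contract[OF assms(1)] by blast
  have "\<exists>T\<in>Sets M. \<forall>u y. pairing M u y \<in> T \<longleftrightarrow> sat M E (e(x := u, z := y)) q"
    by (rule binary_comprehension[of q E x z e]) (use q assms(2) in auto)
  then show ?thesis unfolding q(3) by blast
qed

end

theorem theorem2p3:
  fixes M :: "'a L2_structure"
  assumes "RCA0_star M"
    and "FinCOH M"
  shows "ISigma0 M 1"
proof -
  interpret rca0_star M by unfold_locales (fact assms(1))
  show ?thesis
    unfolding ISigma0_def induction_for_def
  proof (intro allI impI)
    fix \<phi> x e E b
    assume phi: "Sigma0 1 \<phi>" and E: "range E \<subseteq> Sets M"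
      and zero: "sat M E (e(x := \<zero>\<^bsub>M\<^esub>)) \<phi>"
      and step: "\<forall>a. sat M E (e(x := a)) \<phi> \<longrightarrow> sat M E (e(x := a \<oplus>\<^bsub>M\<^esub> \<one>\<^bsub>M\<^esub>)) \<phi>"
    obtain T where T: "T \<in> Sets M"
      "\<And>u. sat M E (e(x := u)) \<phi> \<longleftrightarrow> (\<exists>y. pairing M u y \<in> T)"
      using Sigma0_1_set[OF phi] E by blast
    show "sat M E (e(x := b)) \<phi>"
    proof (rule ccontr)
      assume "\<not> sat M E (e(x := b)) \<phi>"
      \<comment> \<open>If induction fails at \<open>b\<close>, then \<open>b\<close> has no witness
        in \<open>T\<close>, while zero has one and having one passes to successors.\<close>
      then obtain G g where "G \<in> Sets M" "\<And>z x. pairing M z x \<in> G \<longleftrightarrow> x = g z" "\<And>z. le (g z) b"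
        "\<And>z z'. le z z' \<Longrightarrow> le (g z) (g z')" "\<And>z. \<exists>z'. g z \<prec>\<^bsub>M\<^esub> g z'"
        using step_function[OF T(1), of b] zero step unfolding T(2) by blast
      then show False using no_step_function[OF assms(2)] by blast
    qed
  qed
qed

end
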